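(* Let $\phi$ be an expansive flow without singular points on a compact metric space $X$, and let $\psi$ and $N_\epsilon$ be as in the context, with $\epsilon>0$ sufficiently small. Then there is a continuous function $\mathcal L\colon N_\epsilon\to\mathbb{R}$ with the following properties: - $\mathcal L(x,y)\ge0$, with equality if and only if $x=y$; - $\ddot{\mathcal L}=\mathcal L$, where time derivatives are taken along the partial flow $\psi$.
   Context: A flow $\phi$ on a compact metric space $(X,\operatorname{dist})$ is expansive if the following holds. For every $\epsilon>0$ there is $\delta>0$ such that whenever $h\colon\mathbb{R}\to\mathbb{R}$ is continuous with $h(0)=0$ and $\operatorname{dist}(\phi_{h(t)}(x),\phi_t(y))<\delta$ for all $t\in\mathbb{R}$, then $y=\phi_s(x)$ for some $s\in(-\epsilon,\epsilon)$. Local cross sections. For a flow without singular points there are $\delta,\tau,a>0$ such that $\operatorname{dist}(x,y)\le\delta$ implies $\operatorname{dist}(x,\phi_\tau(y))-\operatorname{dist}(x,y)\ge a$. Fix such $\tau$ and set $\theta_x(y)=\int_0^\tau\operatorname{dist}(x,\phi_t(y))\,dt$. For small $\epsilon>0$ let $H_\epsilon(x)=\{y\in X:\operatorname{dist}(x,y)\le\epsilon,\ \theta_x(y)=\theta_x(x)\}$; for $\epsilon$ small these are local cross sections. Let $N_\epsilon=\{(x,y):y\in H_\epsilon(x)\}$. The partial flow $\psi$ on $N_\epsilon$ is $\psi_t(x,y)=(\phi_t(x),\phi_{h(t)}(y))$. It is defined whenever there exists a continuous $h$ on the interval between $0$ and $t$ with $h(0)=0$ and $\phi_{h(s)}(y)\in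 H_\epsilon(\phi_s(x))$ for all $s$ in that interval; such an $h$ is unique if it exists. For a function $\mathcal L$ on $N_\epsilon$, $\dot{\mathcal L}(q)=\frac{d}{dt}\big|_{t=0}\mathcal L(\psi_t(q))$ and $\ddot{\mathcal L}=(\dot{\mathcal L})^{\cdot}$. *)

theory Defs
  imports "HOL-Analysis.Analysis"
begin

definition is_flow :: "(real \<Rightarrow> 'a::metric_space \<Rightarrow> 'a) \<Rightarrow> bool" where
  "is_flow \<phi> \<longleftrightarrow> continuous_on UNIV (\<lambda>(t, x). \<phi> t x) \<and>
     (\<forall>x. \<phi> 0 x = x) \<and> (\<forall>s t x. \<phi> (s + t) x = \<phi> s (\<phi> t x))"

definition expansive_flow :: "(real \<Rightarrow> 'a::metric_space \<Rightarrow> 'a) \<Rightarrow> bool" where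
  "expansive_flow \<phi> \<longleftrightarrow>
     (\<forall>\<epsilon>>0. \<exists>\<delta>>0. \<forall>h x y. continuous_on UNIV h \<and> h 0 = 0 \<and>
        (\<forall>t. dist (\<phi> (h t) x) (\<phi> t y) < \<delta>) \<longrightarrow> (\<exists>s. \<bar>s\<bar> < \<epsilon> \<and> y = \<phi> s x))"

definition singular_point :: "(real \<Rightarrow> 'a \<Rightarrow> 'a) \<Rightarrow> 'a \<Rightarrow> bool" where
  "singular_point \<phi> x \<longleftrightarrow> (\<forall>t. \<phi> t x = x)"

definition cross_section_time :: "(real \<Rightarrow> 'a::metric_space \<Rightarrow> 'a) \<Rightarrow> real \<Rightarrow> bool" where
  "cross_section_time \<phi> \<tau> \<longleftrightarrow> \<tau> > 0 \<and>
     (\<exists>\<delta>>0. \<exists>a>0. \<forall>x y. dist x y \<le> \<delta> \<longrightarrow> dist x (\<phi> \<tau> y) - dist x y \<ge> a)"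

definition theta :: "(real \<Rightarrow> 'a::metric_space \<Rightarrow> 'a) \<Rightarrow> real \<Rightarrow> 'a \<Rightarrow> 'a \<Rightarrow> real" where
  "theta \<phi> \<tau> x y = integral {0..\<tau>} (\<lambda>t. dist x (\<phi> t y))"

definition Hsec :: "(real \<Rightarrow> 'a::metric_space \<Rightarrow> 'a) \<Rightarrow> real \<Rightarrow> real \<Rightarrow> 'a \<Rightarrow> 'a set" where
  "Hsec \<phi> \<tau> \<epsilon> x = {y. dist x y \<le> \<epsilon> \<and> theta \<phi> \<tau> x y = theta \<phi> \<tau> x x}"

definition Nsec :: "(real \<Rightarrow> 'a::metric_space \<Rightarrow> 'a) \<Rightarrow> real \<Rightarrow> real \<Rightarrow> ('a \<times> 'a) set" where
  "Nsec \<phi> \<tau> \<epsilon> = {(x, y). y \<in> Hsec \<phi> \<tau> \<epsilon> x}"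

definition between0 :: "real \<Rightarrow> real set" where
  "between0 t = {min 0 t .. max 0 t}"

definition psi_witness ::
  "(real \<Rightarrow> 'a::metric_space \<Rightarrow> 'a) \<Rightarrow> real \<Rightarrow> real \<Rightarrow> real \<Rightarrow> 'a \<times> 'a \<Rightarrow> (real \<Rightarrow> real) \<Rightarrow> bool" where
  "psi_witness \<phi> \<tau> \<epsilon> t q h \<longleftrightarrow> continuous_on (between0 t) h \<and> h 0 = 0 \<and>
     (\<forall>s\<in>between0 t. \<phi> (h s) (snd q) \<in> Hsec \<phi> \<tau> \<epsilon> (\<phi> s (fst q)))"

definition psi_defined :: "(real \<Rightarrow> 'a::metric_space \<Rightarrow> 'a) \<Rightarrow> real \<Rightarrow> real \<Rightarrow> real \<Rightarrow> 'a \<times> 'a \<Rightarrow> bool" where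
  "psi_defined \<phi> \<tau> \<epsilon> t q \<longleftrightarrow> (\<exists>h. psi_witness \<phi> \<tau> \<epsilon> t q h)"

definition psi_dom :: "(real \<Rightarrow> 'a::metric_space \<Rightarrow> 'a) \<Rightarrow> real \<Rightarrow> real \<Rightarrow> 'a \<times> 'a \<Rightarrow> real set" where
  "psi_dom \<phi> \<tau> \<epsilon> q = {t. psi_defined \<phi> \<tau> \<epsilon> t q}"

text \<open>The partial flow \<open>\<psi>\<^sub>t(x,y) = (\<phi>\<^sub>t x, \<phi>\<^sub>h\<^sub>(\<^sub>t\<^sub>) y)\<close> (meaningful when defined; h is unique).\<close>
definition psi :: "(real \<Rightarrow> 'a::metric_space \<Rightarrow> 'a) \<Rightarrow> real \<Rightarrow> real \<Rightarrow> real \<Rightarrow> 'a \<times> 'a \<Rightarrow> 'a \<times> 'a" where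
  "psi \<phi> \<tau> \<epsilon> t q = (\<phi> t (fst q), \<phi> ((SOME h. psi_witness \<phi> \<tau> \<epsilon> t q h) t) (snd q))"

end

theory Submission
  imports Defs
begin

text \<open>It suffices to find continuous \<open>U, S \<ge> 0\<close> on \<open>N\<^sub>\<epsilon>\<close> with \<open>U (\<psi>\<^sub>t q) = e\<^sup>t U q\<close> and
  \<open>S (\<psi>\<^sub>t q) = e\<^sup>-\<^sup>t S q\<close> that vanish together only on the diagonal: then \<open>L = U + S\<close> has first
  derivative \<open>U - S\<close> and second derivative \<open>L\<close>. For \<open>U\<close> one would like \<open>e\<^sup>-\<^sup>T\<close>, where \<open>T\<close> is the time at
  which the forward orbit of \<open>q\<close> leaves \<open>N\<^sub>\<epsilon>\<close>. Exit times are only semicontinuous, because orbits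
  may touch the boundary, so we take instead the supremum over \<open>c \<in> [0, \<epsilon>]\<close> of \<open>c e\<^sup>-\<^sup>T\<^sup>(\<^sup>c\<^sup>)\<close>, with
  \<open>T(c)\<close> the exit time from \<open>N\<^bsub>\<epsilon> + c\<^esub>\<close>; \<open>S\<close> is the same for backward orbits. If \<open>U q = S q = 0\<close>, the
  whole orbit of \<open>q\<close> stays in \<open>N\<^bsub>2\<epsilon>\<^esub>\<close> and expansivity puts \<open>q\<close> on the diagonal.\<close>

subsection \<open>Flows and the section function\<close>

lemma is_flow_continuous_on:
  assumes "is_flow \<phi>" "continuous_on S f" "continuous_on S g"
  shows "continuous_on S (\<lambda>z. \<phi> (f z) (g z))"
proof -
  have "continuous_on UNIV (\<lambda>(t, x). \<phi> t x)" using assms(1) by (simp add: is_flow_def)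
  from continuous_on_compose2[OF this continuous_on_Pair[OF assms(2,3)]] show ?thesis by simp
qed

lemma is_flow_zero: "is_flow \<phi> \<Longrightarrow> \<phi> 0 x = x"
  by (simp add: is_flow_def)

lemma is_flow_add: "is_flow \<phi> \<Longrightarrow> \<phi> s (\<phi> t x) = \<phi> (s + t) x"
  by (simp add: is_flow_def)

lemma is_flow_equicontinuous:
  fixes \<phi> :: "real \<Rightarrow> 'a::metric_space \<Rightarrow> 'a"
  assumes "compact (UNIV :: 'a set)" "is_flow \<phi>" "\<kappa> > 0"
  obtains \<gamma> where "\<gamma> > 0"
    "\<And>u u' y y'. \<bar>u\<bar> \<le> K \<Longrightarrow> \<bar>u'\<bar> \<le> K \<Longrightarrow> \<bar>u - u'\<bar> < \<gamma> \<Longrightarrow> dist y y' < \<gamma> \<Longrightarrow>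
       dist (\<phi> u y) (\<phi> u' y') < \<kappa>"
proof -
  let ?S = "{-K..K} \<times> (UNIV :: 'a set)"
  have "continuous_on ?S (\<lambda>z. \<phi> (fst z) (snd z))"
    by (intro is_flow_continuous_on[OF assms(2)] continuous_intros)
  moreover have "compact ?S" using assms(1) by (intro compact_Times) auto
  ultimately have "uniformly_continuous_on ?S (\<lambda>z. \<phi> (fst z) (snd z))"
    by (rule compact_uniformly_continuous)
  then obtain \<gamma> where \<gamma>: "\<gamma> > 0"
    "\<And>z z'. z \<in> ?S \<Longrightarrow> z' \<in> ?S \<Longrightarrow> dist z' z < \<gamma> \<Longrightarrow> dist (\<phi> (fst z') (snd z')) (\<phi> (fst z) (snd z)) < \<kappa>"
    using assms(3) unfolding uniformly_continuous_on_def by metis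
  show ?thesis
  proof (rule that[of "\<gamma>/2"])
    fix u u' :: real and y y' :: 'a
    assume *: "\<bar>u\<bar> \<le> K" "\<bar>u'\<bar> \<le> K" "\<bar>u - u'\<bar> < \<gamma>/2" "dist y y' < \<gamma>/2"
    have "dist (u, y) (u', y') \<le> dist u u' + dist y y'"
      unfolding dist_Pair_Pair by (rule sqrt_sum_squares_le_sum) auto
    also have "\<dots> < \<gamma>" using * by (simp add: dist_real_def)
    finally show "dist (\<phi> u y) (\<phi> u' y') < \<kappa>"
      using \<gamma>(2)[of "(u', y')" "(u, y)"] * by (simp add: abs_le_iff)
  qed (use \<gamma>(1) in auto)
qed

lemma is_flow_small_time:
  fixes \<phi> :: "real \<Rightarrow> 'a::metric_space \<Rightarrow> 'a"
  assumes "compact (UNIV :: 'a set)" "is_flow \<phi>" "\<kappa> > 0"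
  obtains \<eta> where "\<eta> > 0" "\<And>s y. \<bar>s\<bar> \<le> \<eta> \<Longrightarrow> dist (\<phi> s y) y < \<kappa>"
proof -
  obtain \<gamma> where \<gamma>: "\<gamma> > 0"
    "\<And>u u' y y'. \<bar>u\<bar> \<le> 1 \<Longrightarrow> \<bar>u'\<bar> \<le> 1 \<Longrightarrow> \<bar>u - u'\<bar> < \<gamma> \<Longrightarrow> dist y y' < \<gamma> \<Longrightarrow>
       dist (\<phi> u y) (\<phi> u' y') < \<kappa>"
    using is_flow_equicontinuous[OF assms] by blast
  show ?thesis
  proof (rule that[of "min 1 (\<gamma>/2)"])
    fix s y assume "\<bar>s\<bar> \<le> min 1 (\<gamma>/2)"
    then show "dist (\<phi> s y) y < \<kappa>"
      using \<gamma>(2)[of s 0 y y] \<gamma>(1) is_flow_zero[OF assms(2)] by auto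
  qed (use \<gamma>(1) in auto)
qed

lemma theta_continuous_on:
  assumes "is_flow \<phi>" "continuous_on S f" "continuous_on S g"
  shows "continuous_on S (\<lambda>z. theta \<phi> \<tau> (f z) (g z))"
proof -
  have "continuous_on (S \<times> cbox 0 \<tau>) (\<lambda>(z, t). dist (f z) (\<phi> t (g z)))"
    unfolding case_prod_unfold
    by (intro continuous_intros is_flow_continuous_on[OF assms(1)]
        continuous_on_compose2[OF assms(2)] continuous_on_compose2[OF assms(3)]) auto
  from integral_continuous_on_param[OF this] show ?thesis
    unfolding theta_def by simp
qed

text \<open>With \<open>f t = dist x (\<phi> t y)\<close>, moving \<open>y\<close> along its orbit
  slides the window of integration \<open>{s..s + \<tau>}\<close>, so the increment is the integral
  over \<open>{s1..s2}\<close> of \<open>f (t + \<tau>) - f t\<close>, which is at least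
  \<open>a\<close>.\<close>

lemma theta_increment:
  assumes flow: "is_flow \<phi>" and "\<tau> > 0" and "s1 \<le> s2"
    and slope: "\<And>s. s1 \<le> s \<Longrightarrow> s \<le> s2 \<Longrightarrow> dist x (\<phi> \<tau> (\<phi> s y)) - dist x (\<phi> s y) \<ge> a"
  shows "theta \<phi> \<tau> x (\<phi> s2 y) - theta \<phi> \<tau> x (\<phi> s1 y) \<ge> a * (s2 - s1)"
proof -
  define f where "f t = dist x (\<phi> t y)" for t
  have cont: "continuous_on S f" for S
    unfolding f_def by (intro continuous_intros is_flow_continuous_on[OF flow])
  then have int: "f integrable_on {u..v}" for u v
    by (rule integrable_continuous_interval)
  have shift: "integral {u..v} (\<lambda>t. f (t + s)) = integral {u + s..v + s} f" for u v s
    using integral_shift[of u s v f] cont by (simp add: add.commute o_def)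
  have th: "theta \<phi> \<tau> x (\<phi> s y) = integral {s..s + \<tau>} f" for s
    using shift[of 0 \<tau> s] by (simp add: theta_def is_flow_add[OF flow] f_def add.commute)
  have "integral {s1..s1+\<tau>} f + integral {s1+\<tau>..s2+\<tau>} f = integral {s1..s2+\<tau>} f"
    using assms(2,3) int by (intro Henstock_Kurzweil_Integration.integral_combine) auto
  moreover have "integral {s1..s2} f + integral {s2..s2+\<tau>} f = integral {s1..s2+\<tau>} f"
    using assms(2,3) int by (intro Henstock_Kurzweil_Integration.integral_combine) auto
  ultimately have "theta \<phi> \<tau> x (\<phi> s2 y) - theta \<phi> \<tau> x (\<phi> s1 y)
      = integral {s1..s2} (\<lambda>t. f (t + \<tau>)) - integral {s1..s2} f"
    unfolding th shift by simp
  also have "\<dots> = integral {s1..s2} (\<lambda>t. f (t + \<tau>) - f t)"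
    by (intro integral_diff[symmetric] integrable_continuous_interval continuous_intros
        continuous_on_compose2[OF cont[of UNIV]]) (auto intro: cont)
  also have "\<dots> \<ge> integral {s1..s2} (\<lambda>t. a)"
    using slope
    by (intro integral_le integrable_continuous_interval continuous_intros
        continuous_on_compose2[OF cont[of UNIV]])
      (auto simp: f_def is_flow_add[OF flow] add.commute intro: cont[unfolded f_def])
  finally show ?thesis using assms(3) by (simp add: mult.commute)
qed

section \<open>Local cross sections with uniform constants\<close>

text \<open>Near \<open>x\<close> the function \<open>theta \<phi> \<tau> x\<close> climbs along
  orbits at rate at least \<open>a\<close> for times up to \<open>\<eta>\<close>, while its starting
  value misses the target by at most half of \<open>a * \<eta>\<close>. Hence an orbit meets the
  section exactly once in that time, with a strict margin.\<close>

locale local_sections =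
  fixes \<phi> :: "real \<Rightarrow> 'a::metric_space \<Rightarrow> 'a" and \<tau> a \<eta> \<rho> :: real
  assumes compact_UNIV: "compact (UNIV :: 'a set)" and flow: "is_flow \<phi>"
    and a_pos: "a > 0" and \<eta>_pos: "\<eta> > 0" and \<rho>_pos: "\<rho> > 0"
    and slope: "\<And>x y s1 s2. dist x y \<le> \<rho> \<Longrightarrow> -\<eta> \<le> s1 \<Longrightarrow> s1 \<le> s2 \<Longrightarrow> s2 \<le> \<eta> \<Longrightarrow>
        theta \<phi> \<tau> x (\<phi> s2 y) - theta \<phi> \<tau> x (\<phi> s1 y) \<ge> a * (s2 - s1)"
    and offset: "\<And>x y. dist x y \<le> \<rho> \<Longrightarrow> \<bar>theta \<phi> \<tau> x y - theta \<phi> \<tau> x x\<bar> \<le> a * \<eta> / 2"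

text \<open>\<open>\<eta>\<close> is chosen first, so that orbit segments of that length drift by
  less than \<open>\<delta>/2\<close>; then \<open>\<rho>\<close> is made small enough for the
  offset, which vanishes on the diagonal and is uniformly continuous.\<close>

lemma local_sections_exist:
  fixes \<phi> :: "real \<Rightarrow> 'a::metric_space \<Rightarrow> 'a"
  assumes "compact (UNIV :: 'a set)" "is_flow \<phi>" "cross_section_time \<phi> \<tau>"
  obtains a \<eta> \<rho> where "local_sections \<phi> \<tau> a \<eta> \<rho>"
proof -
  obtain \<delta> a where \<tau>: "\<tau> > 0" and "\<delta> > 0" and a: "a > 0"
    and sl: "\<And>x y. dist x y \<le> \<delta> \<Longrightarrow> dist x (\<phi> \<tau> y) - dist x y \<ge> a"
    using assms(3) unfolding cross_section_time_def by blast
  then obtain \<eta> where \<eta>: "\<eta> > 0" "\<And>s y. \<bar>s\<bar> \<le> \<eta> \<Longrightarrow> dist (\<phi> s y) y < \<delta>/2"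
    using is_flow_small_time[OF assms(1,2), of "\<delta>/2"] by auto
  let ?G = "\<lambda>z. theta \<phi> \<tau> (fst z) (snd z) - theta \<phi> \<tau> (fst z) (fst z)"
  have "continuous_on (UNIV :: ('a \<times> 'a) set) ?G"
    by (intro continuous_intros theta_continuous_on[OF assms(2)])
  moreover have "compact (UNIV :: ('a \<times> 'a) set)"
    using compact_Times[OF assms(1) assms(1)] by simp
  ultimately have "uniformly_continuous_on UNIV ?G"
    by (rule compact_uniformly_continuous)
  moreover have "a * \<eta> / 2 > 0" using a \<eta> by simp
  ultimately obtain \<gamma> where \<gamma>: "\<gamma> > 0" "\<And>z z'. dist z' z < \<gamma> \<Longrightarrow> dist (?G z') (?G z) < a * \<eta> / 2"
    unfolding uniformly_continuous_on_def by (metis UNIV_I)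
  have "local_sections \<phi> \<tau> a \<eta> (min (\<delta>/2) (\<gamma>/2))"
  proof
    fix x y :: 'a and s1 s2 :: real
    assume *: "dist x y \<le> min (\<delta>/2) (\<gamma>/2)" "-\<eta> \<le> s1" "s1 \<le> s2" "s2 \<le> \<eta>"
    show "theta \<phi> \<tau> x (\<phi> s2 y) - theta \<phi> \<tau> x (\<phi> s1 y) \<ge> a * (s2 - s1)"
    proof (rule theta_increment[OF assms(2) \<tau> *(3)])
      fix s assume "s1 \<le> s" "s \<le> s2"
      then have "dist (\<phi> s y) y < \<delta>/2" using \<eta>(2)[of s y] * by auto
      then have "dist x (\<phi> s y) \<le> \<delta>"
        using dist_triangle[of x "\<phi> s y" y] *(1) by (simp add: dist_commute)
      then show "dist x (\<phi> \<tau> (\<phi> s y)) - dist x (\<phi> s y) \<ge> a" by (rule sl)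
    qed
  next
    fix x y :: 'a
    assume *: "dist x y \<le> min (\<delta>/2) (\<gamma>/2)"
    have "dist (x, y) (x, x) < \<gamma>" using * \<gamma>(1) by (simp add: dist_Pair_Pair dist_commute)
    from \<gamma>(2)[OF this] show "\<bar>theta \<phi> \<tau> x y - theta \<phi> \<tau> x x\<bar> \<le> a * \<eta> / 2"
      by (simp add: dist_real_def)
  qed (use assms a \<eta> \<gamma> \<open>\<delta> > 0\<close> in auto)
  then show ?thesis by (rule that)
qed

context local_sections
begin

lemma slope_abs:
  assumes "dist x y \<le> \<rho>" "\<bar>s\<bar> \<le> \<eta>" "\<bar>s'\<bar> \<le> \<eta>"
  shows "a * \<bar>s - s'\<bar> \<le> \<bar>theta \<phi> \<tau> x (\<phi> s y) - theta \<phi> \<tau> x (\<phi> s' y)\<bar>"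
proof (cases "s \<le> s'")
  case True
  then have "a * (s' - s) \<le> theta \<phi> \<tau> x (\<phi> s' y) - theta \<phi> \<tau> x (\<phi> s y)"
    using assms by (intro slope) auto
  then show ?thesis using True by (simp add: abs_real_def algebra_simps)
next
  case False
  then have "a * (s - s') \<le> theta \<phi> \<tau> x (\<phi> s y) - theta \<phi> \<tau> x (\<phi> s' y)"
    using assms by (intro slope) auto
  then show ?thesis using False by (simp add: abs_real_def algebra_simps)
qed

lemma section_time_unique:
  assumes "dist x y \<le> \<rho>" "\<bar>s\<bar> \<le> \<eta>" "\<bar>s'\<bar> \<le> \<eta>" "theta \<phi> \<tau> x (\<phi> s y) = theta \<phi> \<tau> x (\<phi> s' y)"
  shows "s = s'"
proof -
  have "a * \<bar>s - s'\<bar> \<le> 0" using slope_abs[OF assms(1-3)] assms(4) by simp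
  then show ?thesis using a_pos by (simp add: mult_le_0_iff)
qed

text \<open>The time that carries \<open>y\<close> along its orbit into the section of
  \<open>x\<close>. For \<open>dist x y \<le> \<rho>\<close> it exists and is unique, so the choice
  determines it; farther away nothing is claimed about the value.\<close>

definition section_time :: "'a \<Rightarrow> 'a \<Rightarrow> real" where
  "section_time x y = (SOME s. \<bar>s\<bar> \<le> \<eta> \<and> theta \<phi> \<tau> x (\<phi> s y) = theta \<phi> \<tau> x x)"

text \<open>Intermediate values on \<open>{-\<eta>..\<eta>}\<close>: \<open>slope\<close> moves
  \<open>theta\<close> by at least \<open>a * \<eta>\<close> in either direction, more than the
  offset to be made up.\<close>

lemma section_time:
  assumes "dist x y \<le> \<rho>"
  shows "\<bar>section_time x y\<bar> \<le> \<eta>"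
    and "theta \<phi> \<tau> x (\<phi> (section_time x y) y) = theta \<phi> \<tau> x x"
proof -
  have y: "\<phi> 0 y = y" by (rule is_flow_zero[OF flow])
  have p: "a * \<eta> > 0" using a_pos \<eta>_pos by simp
  have "a * \<eta> \<le> theta \<phi> \<tau> x y - theta \<phi> \<tau> x (\<phi> (-\<eta>) y)"
    "a * \<eta> \<le> theta \<phi> \<tau> x (\<phi> \<eta> y) - theta \<phi> \<tau> x y"
    using slope[of x y "-\<eta>" 0] slope[of x y 0 \<eta>] assms \<eta>_pos y by simp_all
  then have "theta \<phi> \<tau> x (\<phi> (-\<eta>) y) \<le> theta \<phi> \<tau> x x" "theta \<phi> \<tau> x x \<le> theta \<phi> \<tau> x (\<phi> \<eta> y)"
    using offset[OF assms] p by linarith+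
  moreover have "continuous_on {-\<eta>..\<eta>} (\<lambda>s. theta \<phi> \<tau> x (\<phi> s y))"
    by (intro theta_continuous_on[OF flow] is_flow_continuous_on[OF flow] continuous_intros)
  ultimately have "\<exists>s. -\<eta> \<le> s \<and> s \<le> \<eta> \<and> theta \<phi> \<tau> x (\<phi> s y) = theta \<phi> \<tau> x x"
    using IVT'[of "\<lambda>s. theta \<phi> \<tau> x (\<phi> s y)" "-\<eta>" "theta \<phi> \<tau> x x" \<eta>] \<eta>_pos by auto
  then have "\<exists>s. \<bar>s\<bar> \<le> \<eta> \<and> theta \<phi> \<tau> x (\<phi> s y) = theta \<phi> \<tau> x x"
    by (metis abs_le_iff minus_le_iff)
  from someI_ex[OF this, folded section_time_def]
  show "\<bar>section_time x y\<bar> \<le> \<eta>" "theta \<phi> \<tau> x (\<phi> (section_time x y) y) = theta \<phi> \<tau> x x"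
    by auto
qed

lemma section_time_bound:
  assumes "dist x y \<le> \<rho>"
  shows "a * \<bar>section_time x y\<bar> \<le> \<bar>theta \<phi> \<tau> x y - theta \<phi> \<tau> x x\<bar>"
  using slope_abs[of x y "section_time x y" 0] section_time[OF assms] assms \<eta>_pos
    is_flow_zero[OF flow, of y] by (simp add: abs_minus_commute)

text \<open>Freeze the section time \<open>u\<close> at \<open>s0\<close>. By
  \<open>slope_abs\<close> the section time at \<open>s\<close> differs from \<open>u\<close> by at
  most the defect of \<open>u\<close> at \<open>s\<close> divided by \<open>a\<close>, and this
  defect is continuous and vanishes at \<open>s0\<close>.\<close>

lemma section_time_continuous_on:
  fixes f g :: "real \<Rightarrow> 'a"
  assumes f: "continuous_on S f" and g: "continuous_on S g"
    and near: "\<And>s. s \<in> S \<Longrightarrow> dist (f s) (g s) \<le> \<rho>"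
  shows "continuous_on S (\<lambda>s. section_time (f s) (g s))"
  unfolding continuous_on_def
proof
  fix s0 assume s0: "s0 \<in> S"
  define u where "u = section_time (f s0) (g s0)"
  let ?D = "\<lambda>s. theta \<phi> \<tau> (f s) (\<phi> u (g s)) - theta \<phi> \<tau> (f s) (f s)"
  have "continuous_on S (\<lambda>s. \<bar>?D s\<bar> / a)"
    using a_pos by (intro continuous_intros theta_continuous_on[OF flow] is_flow_continuous_on[OF flow] f g) auto
  then have "((\<lambda>s. \<bar>?D s\<bar> / a) \<longlongrightarrow> \<bar>?D s0\<bar> / a) (at s0 within S)"
    using s0 unfolding continuous_on_def by auto
  then have lim: "((\<lambda>s. \<bar>?D s\<bar> / a) \<longlongrightarrow> 0) (at s0 within S)"
    using section_time(2)[OF near[OF s0]] by (simp add: u_def)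
  have "\<bar>section_time (f s) (g s) - u\<bar> \<le> \<bar>?D s\<bar> / a" if "s \<in> S" for s
    using slope_abs[OF near[OF that] section_time(1)[OF near[OF that]] section_time(1)[OF near[OF s0]]]
      section_time(2)[OF near[OF that]] a_pos
    by (simp add: u_def field_simps abs_minus_commute)
  then have "((\<lambda>s. section_time (f s) (g s) - u) \<longlongrightarrow> 0) (at s0 within S)"
    by (intro Lim_null_comparison[OF _ lim]) (auto simp: eventually_at_filter)
  then show "((\<lambda>s. section_time (f s) (g s)) \<longlongrightarrow> section_time (f s0) (g s0)) (at s0 within S)"
    unfolding u_def by (rule LIM_zero_cancel)
qed

subsection \<open>Orbits of the partial flow\<close>

text \<open>Orbits of \<open>\<psi>\<close> are followed for times \<open>\<sigma> s\<close> with \<open>s \<ge> 0\<close>, so that \<open>\<sigma> = 1\<close> and \<open>\<sigma> = - 1\<close> treat both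
  directions of time at once.\<close>

definition witness :: "real \<Rightarrow> real \<Rightarrow> real \<Rightarrow> 'a \<times> 'a \<Rightarrow> (real \<Rightarrow> real) \<Rightarrow> bool" where
  "witness \<sigma> e t q h \<longleftrightarrow> continuous_on {0..t} h \<and> h 0 = 0 \<and>
     (\<forall>s\<in>{0..t}. \<phi> (h s) (snd q) \<in> Hsec \<phi> \<tau> e (\<phi> (\<sigma> * s) (fst q)))"

definition survives :: "real \<Rightarrow> real \<Rightarrow> real \<Rightarrow> 'a \<times> 'a \<Rightarrow> bool" where
  "survives \<sigma> e t q \<longleftrightarrow> (\<exists>h. witness \<sigma> e t q h)"

definition endpoint :: "real \<Rightarrow> real \<Rightarrow> 'a \<times> 'a \<Rightarrow> (real \<Rightarrow> real) \<Rightarrow> 'a \<times> 'a" where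
  "endpoint \<sigma> t q h = (\<phi> (\<sigma> * t) (fst q), \<phi> (h t) (snd q))"

lemma witnessD:
  assumes "witness \<sigma> e t q h" "0 \<le> s" "s \<le> t"
  shows "dist (\<phi> (\<sigma> * s) (fst q)) (\<phi> (h s) (snd q)) \<le> e"
    and "theta \<phi> \<tau> (\<phi> (\<sigma> * s) (fst q)) (\<phi> (h s) (snd q))
       = theta \<phi> \<tau> (\<phi> (\<sigma> * s) (fst q)) (\<phi> (\<sigma> * s) (fst q))"
  using assms by (auto simp: witness_def Hsec_def)

lemma witness_continuous_on: "witness \<sigma> e t q h \<Longrightarrow> continuous_on {0..t} h"
  by (simp add: witness_def)

lemma witness_mono:
  assumes "witness \<sigma> e t q h" "e \<le> e'" "t' \<le> t"
  shows "witness \<sigma> e' t' q h"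
  unfolding witness_def
proof (intro conjI ballI)
  show "continuous_on {0..t'} h"
    using assms by (auto simp: witness_def intro: continuous_on_subset)
  show "h 0 = 0" using assms by (simp add: witness_def)
  fix s assume "s \<in> {0..t'}"
  then have "s \<in> {0..t}" using assms(3) by auto
  then have "\<phi> (h s) (snd q) \<in> Hsec \<phi> \<tau> e (\<phi> (\<sigma> * s) (fst q))"
    using assms(1) unfolding witness_def by blast
  then show "\<phi> (h s) (snd q) \<in> Hsec \<phi> \<tau> e' (\<phi> (\<sigma> * s) (fst q))"
    using assms(2) by (auto simp: Hsec_def)
qed

text \<open>Witnesses that differ by at most \<open>\<eta>\<close> at some time agree there, by
  uniqueness of section times. Their gap is thus 0 or larger than \<open>\<eta>\<close>, and being
  continuous and 0 at time 0 it cannot jump.\<close>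

lemma witness_unique:
  assumes h1: "witness \<sigma> e t q h1" and h2: "witness \<sigma> e t q h2" and e: "e \<le> \<rho>"
    and s: "0 \<le> s" "s \<le> t"
  shows "h1 s = h2 s"
proof (rule ccontr)
  assume ne: "h1 s \<noteq> h2 s"
  define d where "d s = \<bar>h2 s - h1 s\<bar>" for s
  have gap: "d r = 0" if "0 \<le> r" "r \<le> t" "d r \<le> \<eta>" for r
  proof -
    let ?x = "\<phi> (\<sigma> * r) (fst q)" and ?y = "\<phi> (h1 r) (snd q)"
    have y2: "\<phi> (h2 r - h1 r) ?y = \<phi> (h2 r) (snd q)"
      by (simp add: is_flow_add[OF flow])
    have "dist ?x ?y \<le> \<rho>" using witnessD(1)[OF h1 that(1,2)] e by simp
    then have "h2 r - h1 r = 0"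
      by (rule section_time_unique)
        (use witnessD(2)[OF h1 that(1,2)] witnessD(2)[OF h2 that(1,2)] that(3) \<eta>_pos y2
          in \<open>simp_all add: d_def is_flow_zero[OF flow]\<close>)
    then show ?thesis by (simp add: d_def)
  qed
  have cont: "continuous_on {0..s} d"
    using h1 h2 s unfolding d_def witness_def
    by (intro continuous_intros) (auto intro: continuous_on_subset)
  have d0: "d 0 = 0" using h1 h2 by (simp add: d_def witness_def)
  have "d s > \<eta>" using gap[of s] ne s by (force simp: d_def)
  then obtain r where "0 \<le> r" "r \<le> s" "d r = \<eta>"
    using IVT'[of d 0 \<eta> s] cont d0 \<eta>_pos s by auto
  with gap[of r] s \<eta>_pos show False by auto
qed

lemma witness_shift:
  assumes h: "witness \<sigma> e (t + u) q h" and "0 \<le> t"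
  shows "witness \<sigma> e u (endpoint \<sigma> t q h) (\<lambda>s. h (t + s) - h t)"
  unfolding witness_def
proof (intro conjI ballI)
  show "continuous_on {0..u} (\<lambda>s. h (t + s) - h t)"
    using h assms(2)
    by (intro continuous_intros continuous_on_compose2[OF witness_continuous_on[OF h]]) auto
next
  fix s assume "s \<in> {0..u}"
  then show "\<phi> (h (t + s) - h t) (snd (endpoint \<sigma> t q h))
      \<in> Hsec \<phi> \<tau> e (\<phi> (\<sigma> * s) (fst (endpoint \<sigma> t q h)))"
    using h assms(2) unfolding witness_def endpoint_def
    by (auto simp: is_flow_add[OF flow] algebra_simps dest: bspec[of _ _ "t + s"])
qed simp

lemma witness_append:
  assumes h: "witness \<sigma> e t q h" and g: "witness \<sigma> e u (endpoint \<sigma> t q h) g"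
    and "0 \<le> t" "0 \<le> u"
  shows "witness \<sigma> e (t + u) q (\<lambda>s. if s \<le> t then h s else h t + g (s - t))"
  unfolding witness_def
proof (intro conjI ballI)
  have eq: "{0..t+u} = {0..t} \<union> {t..t+u}" using assms by auto
  show "continuous_on {0..t+u} (\<lambda>s. if s \<le> t then h s else h t + g (s - t))"
    unfolding eq
  proof (rule continuous_on_cases)
    show "continuous_on {t..t+u} (\<lambda>s. h t + g (s - t))"
      by (intro continuous_intros continuous_on_compose2[OF witness_continuous_on[OF g]]) auto
  qed (use h g in \<open>auto simp: witness_def\<close>)
next
  fix s assume s: "s \<in> {0..t+u}"
  show "\<phi> (if s \<le> t then h s else h t + g (s - t)) (snd q) \<in> Hsec \<phi> \<tau> e (\<phi> (\<sigma> * s) (fst q))"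
  proof (cases "s \<le> t")
    case True
    then show ?thesis using h s by (auto simp: witness_def)
  next
    case False
    then have "s - t \<in> {0..u}" using s by auto
    then have "\<phi> (g (s - t)) (\<phi> (h t) (snd q)) \<in> Hsec \<phi> \<tau> e (\<phi> (\<sigma> * (s - t)) (\<phi> (\<sigma> * t) (fst q)))"
      using g unfolding witness_def endpoint_def by auto
    then show ?thesis using False by (simp add: is_flow_add[OF flow] algebra_simps)
  qed
qed (use h assms in \<open>auto simp: witness_def\<close>)

text \<open>Running an orbit piece backwards from its endpoint exchanges \<open>\<sigma>\<close> and
  \<open>-\<sigma>\<close>, so that a growth rule for one direction yields a decay rule for the
  other.\<close>

lemma witness_reverse:
  assumes h: "witness \<sigma> e t q h" and "0 \<le> t"
  shows "witness (-\<sigma>) e t (endpoint \<sigma> t q h) (\<lambda>s. h (t - s) - h t)"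
    and "endpoint (-\<sigma>) t (endpoint \<sigma> t q h) (\<lambda>s. h (t - s) - h t) = q"
proof -
  show "witness (-\<sigma>) e t (endpoint \<sigma> t q h) (\<lambda>s. h (t - s) - h t)"
    unfolding witness_def
  proof (intro conjI ballI)
    show "continuous_on {0..t} (\<lambda>s. h (t - s) - h t)"
      by (intro continuous_intros continuous_on_compose2[OF witness_continuous_on[OF h]]) auto
  next
    fix s assume "s \<in> {0..t}"
    then show "\<phi> (h (t - s) - h t) (snd (endpoint \<sigma> t q h))
        \<in> Hsec \<phi> \<tau> e (\<phi> (- \<sigma> * s) (fst (endpoint \<sigma> t q h)))"
      using h unfolding witness_def endpoint_def
      by (auto simp: is_flow_add[OF flow] algebra_simps dest: bspec[of _ _ "t - s"])
  qed simp
  show "endpoint (-\<sigma>) t (endpoint \<sigma> t q h) (\<lambda>s. h (t - s) - h t) = q"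
    using h by (simp add: endpoint_def witness_def is_flow_add[OF flow] is_flow_zero[OF flow])
qed

section \<open>A priori bound and perturbation of orbits\<close>

text \<open>The bound is uniform over all orbits: a witness moves by at most \<open>\<eta>\<close>
  in any time span of length \<open>T0\<close>, and finitely many such spans cover the times up to
  \<open>T\<close>.\<close>

lemma witness_bounded:
  assumes \<sigma>: "\<bar>\<sigma>\<bar> \<le> 1"
  obtains K where "K \<ge> 0" "\<And>e t q h s. witness \<sigma> e t q h \<Longrightarrow> e \<le> \<rho>/2 \<Longrightarrow> 0 \<le> s \<Longrightarrow> s \<le> t \<Longrightarrow> s \<le> T \<Longrightarrow> \<bar>h s\<bar> \<le> K"
proof -
  obtain T0 where T0: "T0 > 0" "\<And>s y. \<bar>s\<bar> \<le> T0 \<Longrightarrow> dist (\<phi> s y) y < \<rho>/2"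
    using is_flow_small_time[OF compact_UNIV flow, of "\<rho>/2"] \<rho>_pos by auto
  have step: "\<bar>h r' - h r\<bar> \<le> \<eta>"
    if h: "witness \<sigma> e t q h" "e \<le> \<rho>/2" and r: "0 \<le> r" "r \<le> r'" "r' \<le> t" "r' - r \<le> T0"
    for e t q h r r'
  proof (rule ccontr)
    assume big: "\<not> \<bar>h r' - h r\<bar> \<le> \<eta>"
    have "continuous_on {r..r'} (\<lambda>s. \<bar>h s - h r\<bar>)"
      using h(1) r unfolding witness_def
      by (intro continuous_intros) (auto intro: continuous_on_subset)
    then obtain v where v: "r \<le> v" "v \<le> r'" "\<bar>h v - h r\<bar> = \<eta>"
      using IVT'[of "\<lambda>s. \<bar>h s - h r\<bar>" r \<eta> r'] big r \<eta>_pos by auto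
    \<comment> \<open>The section is taken at time \<open>v\<close>, but the second point is left at
      \<open>h r\<close>. The pair is still within \<open>\<rho>\<close>, half from \<open>e\<close>
      and half from the drift of the first point, so the offset is at most
      \<open>a * \<eta> / 2\<close>, whereas a section time of size \<open>\<eta>\<close> forces at
      least \<open>a * \<eta>\<close>.\<close>
    let ?x = "\<phi> (\<sigma> * v) (fst q)" and ?y = "\<phi> (h r) (snd q)"
    have "\<bar>\<sigma> * (v - r)\<bar> \<le> 1 * T0"
      unfolding abs_mult using \<sigma> v r by (intro mult_mono) auto
    then have "dist (\<phi> (\<sigma> * (v - r)) (\<phi> (\<sigma> * r) (fst q))) (\<phi> (\<sigma> * r) (fst q)) < \<rho>/2"
      by (intro T0(2)) simp
    then have "dist ?x (\<phi> (\<sigma> * r) (fst q)) < \<rho>/2"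
      by (simp add: is_flow_add[OF flow] algebra_simps)
    moreover have "dist (\<phi> (\<sigma> * r) (fst q)) ?y \<le> \<rho>/2"
      using witnessD(1)[OF h(1), of r] r h(2) by auto
    ultimately have near: "dist ?x ?y \<le> \<rho>"
      using dist_triangle[of ?x ?y "\<phi> (\<sigma> * r) (fst q)"] by simp
    have "theta \<phi> \<tau> ?x (\<phi> (h v - h r) ?y) = theta \<phi> \<tau> ?x ?x"
      using witnessD(2)[OF h(1), of v] v r by (simp add: is_flow_add[OF flow])
    then have "a * \<eta> \<le> \<bar>theta \<phi> \<tau> ?x ?x - theta \<phi> \<tau> ?x ?y\<bar>"
      using slope_abs[OF near, of "h v - h r" 0] v \<eta>_pos is_flow_zero[OF flow] by simp
    moreover have "a * \<eta> > 0" using a_pos \<eta>_pos by simp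
    ultimately show False using offset[OF near] by linarith
  qed
  have many: "\<bar>h s\<bar> \<le> n * \<eta>"
    if h: "witness \<sigma> e t q h" "e \<le> \<rho>/2" and s: "0 \<le> s" "s \<le> t" "s \<le> n * T0" for e t q h s and n :: nat
    using s
  proof (induction n arbitrary: s)
    case 0
    then show ?case using h by (simp add: witness_def)
  next
    case (Suc n)
    define r where "r = max 0 (s - T0)"
    have "\<bar>h r\<bar> \<le> n * \<eta>"
      using Suc.prems T0(1) by (intro Suc.IH) (auto simp: r_def algebra_simps)
    moreover have "\<bar>h s - h r\<bar> \<le> \<eta>"
      using Suc.prems T0(1) by (intro step[OF h]) (auto simp: r_def)
    ultimately show ?case by (simp add: algebra_simps)
  qed
  obtain n :: nat where "T / T0 \<le> n" using real_arch_simple by blast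
  then have "T \<le> n * T0" using T0(1) by (simp add: field_simps)
  then show ?thesis using many \<eta>_pos by (intro that[of "n * \<eta>"]) force+
qed

text \<open>A witness \<open>h\<close> for \<open>q\<close> becomes one for a nearby \<open>q'\<close> after adding the short time that moves
  \<open>\<phi>\<^bsub>h s\<^esub> y'\<close> back into the section of \<open>\<phi>\<^bsub>\<sigma> s\<^esub> x'\<close>.\<close>

lemma survives_perturb:
  assumes \<sigma>: "\<bar>\<sigma>\<bar> \<le> 1" and \<kappa>: "\<kappa> > 0"
  obtains \<gamma> where "\<gamma> > 0"
    "\<And>e t q q'. dist q q' < \<gamma> \<Longrightarrow> q' \<in> Nsec \<phi> \<tau> (\<rho>/2) \<Longrightarrow> survives \<sigma> e t q \<Longrightarrow> e \<le> \<rho>/2 \<Longrightarrow> t \<le> T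
      \<Longrightarrow> survives \<sigma> (e + \<kappa>) t q'"
proof -
  let ?G = "\<lambda>z. theta \<phi> \<tau> (fst z) (snd z) - theta \<phi> \<tau> (fst z) (fst z)"
  obtain \<eta>2 where \<eta>2: "\<eta>2 > 0" "\<And>s y. \<bar>s\<bar> \<le> \<eta>2 \<Longrightarrow> dist (\<phi> s y) y < \<kappa>/3"
    using is_flow_small_time[OF compact_UNIV flow, of "\<kappa>/3"] \<kappa> by auto
  have "continuous_on (UNIV :: ('a \<times> 'a) set) ?G"
    by (intro continuous_intros theta_continuous_on[OF flow])
  moreover have "compact (UNIV :: ('a \<times> 'a) set)"
    using compact_Times[OF compact_UNIV compact_UNIV] by simp
  ultimately have "uniformly_continuous_on UNIV ?G"
    by (rule compact_uniformly_continuous)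
  moreover have "a * \<eta>2 > 0" using a_pos \<eta>2 by simp
  ultimately obtain \<gamma>1 where \<gamma>1: "\<gamma>1 > 0" "\<And>z z'. dist z' z < \<gamma>1 \<Longrightarrow> dist (?G z') (?G z) < a * \<eta>2"
    unfolding uniformly_continuous_on_def by (metis UNIV_I)
  \<comment> \<open>Errors below \<open>\<mu>\<close> in both points cost at most two thirds of
    \<open>\<kappa>\<close>, leaving one third for the correction along the orbit. They keep the
    pair within \<open>\<rho>/2 + 2 * (\<rho>/4) = \<rho>\<close> and change \<open>?G\<close> by
    less than \<open>a * \<eta>2\<close>.\<close>
  define \<mu> where "\<mu> = min (\<kappa>/3) (min (\<rho>/4) (\<gamma>1/2))"
  have \<mu>: "\<mu> > 0" "\<mu> \<le> \<kappa>/3" "\<mu> \<le> \<rho>/4" "\<mu> \<le> \<gamma>1/2" using \<kappa> \<rho>_pos \<gamma>1(1) by (auto simp: \<mu>_def)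
  obtain K where K: "K \<ge> 0"
    "\<And>e t q h s. witness \<sigma> e t q h \<Longrightarrow> e \<le> \<rho>/2 \<Longrightarrow> 0 \<le> s \<Longrightarrow> s \<le> t \<Longrightarrow> s \<le> T \<Longrightarrow> \<bar>h s\<bar> \<le> K"
    using witness_bounded[OF \<sigma>] by blast
  \<comment> \<open>The first point is flowed for times bounded by \<open>T\<close>, the second for
    times \<open>h s\<close> bounded by \<open>K\<close>.\<close>
  obtain \<gamma> where \<gamma>: "\<gamma> > 0"
    "\<And>u u' y y'. \<bar>u\<bar> \<le> max K T \<Longrightarrow> \<bar>u'\<bar> \<le> max K T \<Longrightarrow> \<bar>u - u'\<bar> < \<gamma> \<Longrightarrow> dist y y' < \<gamma> \<Longrightarrow>
       dist (\<phi> u y) (\<phi> u' y') < \<mu>"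
    using is_flow_equicontinuous[OF compact_UNIV flow \<mu>(1)] by blast
  show ?thesis
  proof (rule that[OF \<gamma>(1)])
    fix e t q q'
    assume qq: "dist q q' < \<gamma>" and q': "q' \<in> Nsec \<phi> \<tau> (\<rho>/2)" and surv: "survives \<sigma> e t q"
      and e: "e \<le> \<rho>/2" and t: "t \<le> T"
    from surv obtain h where h: "witness \<sigma> e t q h" by (auto simp: survives_def)
    define X where "X s = \<phi> (\<sigma> * s) (fst q)" for s
    define Y where "Y s = \<phi> (h s) (snd q)" for s
    define X' where "X' s = \<phi> (\<sigma> * s) (fst q')" for s
    define Y' where "Y' s = \<phi> (h s) (snd q')" for s
    define k where "k s = section_time (X' s) (Y' s)" for s
    have d: "dist (fst q) (fst q') < \<gamma>" "dist (snd q) (snd q') < \<gamma>"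
      using qq dist_fst_le[of q q'] dist_snd_le[of q q'] by auto
    have XX: "dist (X s) (X' s) < \<mu>" and YY: "dist (Y s) (Y' s) < \<mu>"
      and XY: "dist (X s) (Y s) \<le> e" and th: "?G (X s, Y s) = 0"
      and near: "dist (X' s) (Y' s) \<le> \<rho>"
      if s: "0 \<le> s" "s \<le> t" for s
    proof -
      have "\<bar>\<sigma> * s\<bar> \<le> 1 * T"
        unfolding abs_mult using \<sigma> s t by (intro mult_mono) auto
      then show 1: "dist (X s) (X' s) < \<mu>"
        unfolding X_def X'_def using d(1) \<gamma>(1) by (intro \<gamma>(2)) auto
      show 2: "dist (Y s) (Y' s) < \<mu>"
        unfolding Y_def Y'_def using d(2) \<gamma>(1) K(2)[OF h e s] s t by (intro \<gamma>(2)) auto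
      show 3: "dist (X s) (Y s) \<le> e" "?G (X s, Y s) = 0"
        using witnessD[OF h s] by (simp_all add: X_def Y_def)
      show "dist (X' s) (Y' s) \<le> \<rho>"
        using 1 2 3(1) e \<mu>(3) dist_triangle[of "X' s" "Y' s" "X s"] dist_triangle[of "X s" "Y' s" "Y s"]
        by (simp add: dist_commute)
    qed
    have small: "\<bar>k s\<bar> \<le> \<eta>2" if s: "0 \<le> s" "s \<le> t" for s
    proof -
      have "dist (X' s, Y' s) (X s, Y s) \<le> dist (X' s) (X s) + dist (Y' s) (Y s)"
        unfolding dist_Pair_Pair by (rule sqrt_sum_squares_le_sum) auto
      also have "\<dots> < \<gamma>1" using XX[OF s] YY[OF s] \<mu>(4) by (simp add: dist_commute)
      finally have "\<bar>?G (X' s, Y' s)\<bar> < a * \<eta>2"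
        using \<gamma>1(2)[of "(X' s, Y' s)" "(X s, Y s)"] th[OF s] by (simp add: dist_real_def)
      with section_time_bound[OF near[OF s]] have "a * \<bar>k s\<bar> \<le> a * \<eta>2" by (simp add: k_def)
      then show ?thesis using a_pos by simp
    qed
    have "witness \<sigma> (e + \<kappa>) t q' (\<lambda>s. h s + k s)"
      unfolding witness_def
    proof (intro conjI ballI)
      have ch: "continuous_on {0..t} h" using h by (simp add: witness_def)
      show "continuous_on {0..t} (\<lambda>s. h s + k s)"
        unfolding k_def
        by (intro continuous_intros ch section_time_continuous_on)
          (auto simp: near, auto simp: X'_def Y'_def intro!: is_flow_continuous_on[OF flow] continuous_intros ch)
      have h0: "h 0 = 0" using h by (simp add: witness_def)
      \<comment> \<open>Since \<open>q'\<close> lies in its own section, no correction is made at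
        time 0, so the new witness also starts at 0.\<close>
      have "dist (fst q') (snd q') \<le> \<rho>" "theta \<phi> \<tau> (fst q') (snd q') = theta \<phi> \<tau> (fst q') (fst q')"
        using q' \<rho>_pos by (auto simp: Nsec_def Hsec_def)
      then have "section_time (fst q') (snd q') = 0"
        using section_time_bound[of "fst q'" "snd q'"] a_pos by (simp add: mult_le_0_iff)
      then show "h 0 + k 0 = 0"
        by (simp add: k_def X'_def Y'_def h0 is_flow_zero[OF flow])
    next
      fix s assume "s \<in> {0..t}"
      then have s: "0 \<le> s" "s \<le> t" by auto
      have y: "\<phi> (h s + k s) (snd q') = \<phi> (k s) (Y' s)"
        by (simp add: Y'_def is_flow_add[OF flow] add.commute)
      have "dist (\<phi> (k s) (Y' s)) (Y' s) < \<kappa>/3" by (rule \<eta>2(2)[OF small[OF s]])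
      then have "dist (X' s) (\<phi> (k s) (Y' s)) \<le> e + \<kappa>"
        using XX[OF s] YY[OF s] XY[OF s] \<mu>(2) dist_triangle[of "X' s" "\<phi> (k s) (Y' s)" "X s"]
          dist_triangle[of "X s" "\<phi> (k s) (Y' s)" "Y s"] dist_triangle[of "Y s" "\<phi> (k s) (Y' s)" "Y' s"]
        by (simp add: dist_commute)
      then show "\<phi> (h s + k s) (snd q') \<in> Hsec \<phi> \<tau> (e + \<kappa>) (\<phi> (\<sigma> * s) (fst q'))"
        using section_time(2)[OF near[OF s], folded k_def]
        unfolding y Hsec_def X'_def[symmetric] by simp
    qed
    then show "survives \<sigma> (e + \<kappa>) t q'" by (auto simp: survives_def)
  qed
qed

subsection \<open>Weighted exit times\<close>

definition escape_values :: "real \<Rightarrow> real \<Rightarrow> 'a \<times> 'a \<Rightarrow> real set" where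
  "escape_values \<epsilon> \<sigma> q =
     {c * exp (- t) | c t. 0 \<le> t \<and> 0 \<le> c \<and> c \<le> \<epsilon> \<and> (c = 0 \<or> \<not> survives \<sigma> (\<epsilon> + c) t q)}"

definition escape :: "real \<Rightarrow> real \<Rightarrow> 'a \<times> 'a \<Rightarrow> real" where
  "escape \<epsilon> \<sigma> q = Sup (escape_values \<epsilon> \<sigma> q)"

lemma escape_upper:
  assumes "0 \<le> t" "0 \<le> c" "c \<le> \<epsilon>" "c = 0 \<or> \<not> survives \<sigma> (\<epsilon> + c) t q"
  shows "c * exp (- t) \<le> escape \<epsilon> \<sigma> q"
  unfolding escape_def
proof (rule cSup_upper)
  show "c * exp (- t) \<in> escape_values \<epsilon> \<sigma> q" unfolding escape_values_def using assms by blast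
  show "bdd_above (escape_values \<epsilon> \<sigma> q)"
  proof (rule bdd_aboveI[of _ \<epsilon>])
    fix v assume "v \<in> escape_values \<epsilon> \<sigma> q"
    then obtain c t where v: "v = c * exp (- t)" "0 \<le> t" "0 \<le> c" "c \<le> \<epsilon>"
      by (auto simp: escape_values_def)
    then have "c * exp (- t) \<le> \<epsilon> * 1" by (intro mult_mono) auto
    then show "v \<le> \<epsilon>" using v by simp
  qed
qed

lemma escape_least:
  assumes "\<And>c t. 0 \<le> t \<Longrightarrow> 0 < c \<Longrightarrow> c \<le> \<epsilon> \<Longrightarrow> \<not> survives \<sigma> (\<epsilon> + c) t q \<Longrightarrow> c * exp (- t) \<le> B"
    and "0 \<le> B" "0 \<le> \<epsilon>"
  shows "escape \<epsilon> \<sigma> q \<le> B"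
  unfolding escape_def
proof (rule cSup_least)
  show "escape_values \<epsilon> \<sigma> q \<noteq> {}" using assms(3) by (auto simp: escape_values_def)
  fix v assume "v \<in> escape_values \<epsilon> \<sigma> q"
  then obtain c t where v: "v = c * exp (- t)" "0 \<le> t" "0 \<le> c" "c \<le> \<epsilon>"
    "c = 0 \<or> \<not> survives \<sigma> (\<epsilon> + c) t q"
    by (auto simp: escape_values_def)
  show "v \<le> B"
  proof (cases "c = 0")
    case False
    then show ?thesis using assms(1)[of t c] v by auto
  qed (use v assms(2) in simp)
qed

lemma escape_nonneg: "0 \<le> \<epsilon> \<Longrightarrow> 0 \<le> escape \<epsilon> \<sigma> q"
  using escape_upper[of 0 0 \<epsilon> \<sigma> q] by simp

text \<open>While \<open>h\<close> keeps the orbit within radius \<open>\<epsilon>\<close>, it also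
  stays within every \<open>\<epsilon> + c\<close>, so for each weight the exit time drops by
  exactly \<open>t\<close>.\<close>

lemma escape_endpoint:
  assumes h: "witness \<sigma> \<epsilon> t q h" and t: "0 \<le> t" and \<epsilon>: "0 \<le> \<epsilon>" "2 * \<epsilon> \<le> \<rho>"
  shows "escape \<epsilon> \<sigma> (endpoint \<sigma> t q h) = exp t * escape \<epsilon> \<sigma> q"
proof (rule antisym)
  let ?p = "endpoint \<sigma> t q h"
  show "escape \<epsilon> \<sigma> ?p \<le> exp t * escape \<epsilon> \<sigma> q"
  proof (rule escape_least)
    fix c u assume c: "0 \<le> u" "0 < c" "c \<le> \<epsilon>" "\<not> survives \<sigma> (\<epsilon> + c) u ?p"
    have "\<not> survives \<sigma> (\<epsilon> + c) (t + u) q"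
    proof
      assume "survives \<sigma> (\<epsilon> + c) (t + u) q"
      then obtain g where g: "witness \<sigma> (\<epsilon> + c) (t + u) q g" by (auto simp: survives_def)
      \<comment> \<open>Uniqueness applies because \<open>\<epsilon> + c \<le> \<rho>\<close>; it
        makes the orbit followed by \<open>g\<close> pass through \<open>?p\<close>.\<close>
      have "g t = h t"
      proof (rule witness_unique[of \<sigma> "\<epsilon> + c" t q g h t])
        show "witness \<sigma> (\<epsilon> + c) t q g" using g c by (auto intro: witness_mono)
        show "witness \<sigma> (\<epsilon> + c) t q h" using h c by (auto intro: witness_mono)
      qed (use t c \<epsilon> in auto)
      then have "endpoint \<sigma> t q g = ?p" by (simp add: endpoint_def)
      with witness_shift[OF g t] c(4) show False by (auto simp: survives_def)
    qed
    then have "c * exp (- (t + u)) \<le> escape \<epsilon> \<sigma> q"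
      using c t by (intro escape_upper) auto
    then have "exp t * (c * exp (- (t + u))) \<le> exp t * escape \<epsilon> \<sigma> q" by simp
    also have "exp t * (c * exp (- (t + u))) = c * exp (- u)"
      by (simp add: exp_add[symmetric] exp_diff exp_minus field_simps)
    finally show "c * exp (- u) \<le> exp t * escape \<epsilon> \<sigma> q" .
  qed (use \<epsilon> escape_nonneg in auto)
  have "escape \<epsilon> \<sigma> q \<le> exp (- t) * escape \<epsilon> \<sigma> ?p"
  proof (rule escape_least)
    fix c u assume c: "0 \<le> u" "0 < c" "c \<le> \<epsilon>" "\<not> survives \<sigma> (\<epsilon> + c) u q"
    have hc: "witness \<sigma> (\<epsilon> + c) t q h" using h c by (auto intro: witness_mono)
    \<comment> \<open>Exit from \<open>q\<close> cannot occur before \<open>t\<close>, up to which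
      \<open>h\<close> itself is a witness; the rest of the orbit has length
      \<open>u - t\<close>.\<close>
    have ut: "t \<le> u"
    proof (rule ccontr)
      assume "\<not> t \<le> u"
      then have "witness \<sigma> (\<epsilon> + c) u q h" using hc by (auto intro: witness_mono)
      then show False using c(4) by (auto simp: survives_def)
    qed
    have "\<not> survives \<sigma> (\<epsilon> + c) (u - t) ?p"
      using witness_append[OF hc _ t, of "u - t"] c(4) ut by (auto simp: survives_def)
    then have "c * exp (- (u - t)) \<le> escape \<epsilon> \<sigma> ?p"
      using c ut by (intro escape_upper) auto
    then have "exp (- t) * (c * exp (- (u - t))) \<le> exp (- t) * escape \<epsilon> \<sigma> ?p" by simp
    also have "exp (- t) * (c * exp (- (u - t))) = c * exp (- u)"
      by (simp add: exp_diff exp_minus field_simps)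
    finally show "c * exp (- u) \<le> exp (- t) * escape \<epsilon> \<sigma> ?p" .
  qed (use \<epsilon> escape_nonneg in auto)
  then show "exp t * escape \<epsilon> \<sigma> q \<le> escape \<epsilon> \<sigma> ?p"
    by (simp add: exp_minus field_simps)
qed

lemma escape_endpoint_reverse:
  assumes h: "witness \<sigma> \<epsilon> t q h" and t: "0 \<le> t" and \<epsilon>: "0 \<le> \<epsilon>" "2 * \<epsilon> \<le> \<rho>"
  shows "escape \<epsilon> (-\<sigma>) (endpoint \<sigma> t q h) = exp (- t) * escape \<epsilon> (-\<sigma>) q"
  using escape_endpoint[OF witness_reverse(1)[OF h t] t \<epsilon>] witness_reverse(2)[OF h t]
  by (simp add: exp_minus field_simps)

text \<open>A one-sided estimate with a modulus independent of the points suffices, since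
  \<open>q\<close> and \<open>q'\<close> can be exchanged. All thresholds
  \<open>\<epsilon> + c\<close> are at most \<open>\<rho>/2\<close>, as
  \<open>survives_perturb\<close> requires.\<close>

lemma escape_continuous_on:
  assumes \<sigma>: "\<bar>\<sigma>\<bar> \<le> 1" and \<epsilon>: "0 < \<epsilon>" "4 * \<epsilon> \<le> \<rho>"
  shows "continuous_on (Nsec \<phi> \<tau> \<epsilon>) (escape \<epsilon> \<sigma>)"
proof -
  have sub: "q \<in> Nsec \<phi> \<tau> (\<rho>/2)" if "q \<in> Nsec \<phi> \<tau> \<epsilon>" for q
    using that \<epsilon> by (auto simp: Nsec_def Hsec_def)
  have "\<exists>\<gamma>>0. \<forall>q\<in>Nsec \<phi> \<tau> \<epsilon>. \<forall>q'\<in>Nsec \<phi> \<tau> \<epsilon>. dist q' q < \<gamma> \<longrightarrow>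
      escape \<epsilon> \<sigma> q' \<le> escape \<epsilon> \<sigma> q + \<kappa>" if \<kappa>: "\<kappa> > 0" for \<kappa>
  proof -
    \<comment> \<open>After time \<open>T\<close> even the largest weight gives
      \<open>\<epsilon> * exp (- t) \<le> \<kappa>\<close>, which leaves a bounded time range for
      the perturbation.\<close>
    define T where "T = max 0 (ln (\<epsilon> / \<kappa>))"
    obtain \<gamma> where \<gamma>: "\<gamma> > 0"
      "\<And>e t q q'. dist q q' < \<gamma> \<Longrightarrow> q' \<in> Nsec \<phi> \<tau> (\<rho>/2) \<Longrightarrow> survives \<sigma> e t q \<Longrightarrow> e \<le> \<rho>/2 \<Longrightarrow> t \<le> T
        \<Longrightarrow> survives \<sigma> (e + \<kappa>) t q'"
      using survives_perturb[OF \<sigma> \<kappa>] by blast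
    have "escape \<epsilon> \<sigma> q' \<le> escape \<epsilon> \<sigma> q + \<kappa>"
      if q: "q \<in> Nsec \<phi> \<tau> \<epsilon>" "q' \<in> Nsec \<phi> \<tau> \<epsilon>" "dist q' q < \<gamma>" for q q'
    proof (rule escape_least)
      have nn: "0 \<le> escape \<epsilon> \<sigma> q" using \<epsilon> by (intro escape_nonneg) auto
      then show "0 \<le> escape \<epsilon> \<sigma> q + \<kappa>" using \<kappa> by simp
      fix c t assume c: "0 \<le> t" "0 < c" "c \<le> \<epsilon>" "\<not> survives \<sigma> (\<epsilon> + c) t q'"
      have e1: "exp (- t) \<le> 1" using c by simp
      consider "t > T" | "c \<le> \<kappa>" | "t \<le> T" "\<kappa> < c" by linarith
      then show "c * exp (- t) \<le> escape \<epsilon> \<sigma> q + \<kappa>"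
      proof cases
        case 1
        then have "ln (\<epsilon> / \<kappa>) \<le> t" by (simp add: T_def)
        then have "\<epsilon> / \<kappa> \<le> exp t" using \<epsilon> \<kappa> exp_le_cancel_iff[of "ln (\<epsilon> / \<kappa>)" t] by simp
        then have "\<epsilon> * exp (- t) \<le> \<kappa>" using \<kappa> by (simp add: exp_minus field_simps)
        moreover have "c * exp (- t) \<le> \<epsilon> * exp (- t)" using c by simp
        ultimately show ?thesis using nn by linarith
      next
        case 2
        have "c * exp (- t) \<le> c * 1" using e1 c by (intro mult_left_mono) auto
        then show ?thesis using nn 2 by linarith
      next
        case 3
        \<comment> \<open>Perturbation raises the threshold by \<open>\<kappa>\<close>, so survival
          of \<open>q\<close> at the lowered threshold would carry over to \<open>q'\<close>. Hence
          \<open>c - \<kappa>\<close> is an admissible weight for \<open>q\<close>, at a loss of at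
          most \<open>\<kappa>\<close>.\<close>
        have "\<not> survives \<sigma> (\<epsilon> + (c - \<kappa>)) t q"
        proof
          assume "survives \<sigma> (\<epsilon> + (c - \<kappa>)) t q"
          then have "survives \<sigma> (\<epsilon> + (c - \<kappa>) + \<kappa>) t q'"
            using q \<epsilon> c \<kappa> 3 sub by (intro \<gamma>(2)[of q q']) (auto simp: dist_commute)
          then show False using c(4) by simp
        qed
        then have "(c - \<kappa>) * exp (- t) \<le> escape \<epsilon> \<sigma> q"
          using c 3 \<kappa> by (intro escape_upper) auto
        moreover have "\<kappa> * exp (- t) \<le> \<kappa> * 1" using e1 \<kappa> by (intro mult_left_mono) auto
        ultimately show ?thesis by (simp add: algebra_simps)
      qed
    qed (use \<epsilon> in auto)
    then show ?thesis using \<gamma>(1) by blast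
  qed
  note semi = this
  show ?thesis
    unfolding continuous_on_iff
  proof (intro ballI allI impI)
    fix q and \<kappa> :: real assume q: "q \<in> Nsec \<phi> \<tau> \<epsilon>" and \<kappa>: "0 < \<kappa>"
    then obtain \<gamma> where \<gamma>: "\<gamma> > 0" "\<And>q q'. q \<in> Nsec \<phi> \<tau> \<epsilon> \<Longrightarrow> q' \<in> Nsec \<phi> \<tau> \<epsilon> \<Longrightarrow> dist q' q < \<gamma> \<Longrightarrow>
        escape \<epsilon> \<sigma> q' \<le> escape \<epsilon> \<sigma> q + \<kappa>/2"
      using semi[of "\<kappa>/2"] by auto
    show "\<exists>d>0. \<forall>q'\<in>Nsec \<phi> \<tau> \<epsilon>. dist q' q < d \<longrightarrow> dist (escape \<epsilon> \<sigma> q') (escape \<epsilon> \<sigma> q) < \<kappa>"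
    proof (intro exI[of _ \<gamma>] conjI ballI impI)
      fix q' assume "q' \<in> Nsec \<phi> \<tau> \<epsilon>" "dist q' q < \<gamma>"
      then show "dist (escape \<epsilon> \<sigma> q') (escape \<epsilon> \<sigma> q) < \<kappa>"
        using \<gamma>(2)[of q q'] \<gamma>(2)[of q' q] q \<kappa> by (auto simp: dist_real_def dist_commute)
    qed (rule \<gamma>(1))
  qed
qed

section \<open>Both exit values vanish exactly on the diagonal\<close>

text \<open>Failure at the largest weight \<open>c = \<epsilon>\<close> would already make the
  supremum positive.\<close>

lemma escape_zero_imp_survives:
  assumes "escape \<epsilon> \<sigma> q = 0" "0 < \<epsilon>" "0 \<le> t"
  shows "survives \<sigma> (2 * \<epsilon>) t q"
proof (rule ccontr)
  assume "\<not> ?thesis"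
  then have "\<epsilon> * exp (- t) \<le> escape \<epsilon> \<sigma> q"
    using assms by (intro escape_upper) auto
  then show False using assms by (simp add: mult_le_0_iff)
qed

text \<open>Witnesses for integer horizons agree on overlaps by uniqueness, so taking at each
  \<open>s\<close> the one with the least horizon covering \<open>s\<close> defines a common
  extension.\<close>

lemma survives_forever_witness:
  assumes "\<And>t. 0 \<le> t \<Longrightarrow> survives \<sigma> e t q" "e \<le> \<rho>"
  obtains h where "\<And>t. witness \<sigma> e t q h"
proof -
  obtain g where g: "\<And>n. witness \<sigma> e (real n) q (g n)"
    using choice[of "\<lambda>n g. witness \<sigma> e (real n) q g"] assms(1) by (auto simp: survives_def)
  define h where "h s = g (nat \<lceil>s\<rceil>) s" for s
  have eq: "h s = g n s" if "0 \<le> s" "s \<le> n" for s n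
  proof -
    have le: "nat \<lceil>s\<rceil> \<le> n" "s \<le> nat \<lceil>s\<rceil>" using that by linarith+
    have "witness \<sigma> e (real (nat \<lceil>s\<rceil>)) q (g n)"
      using le(1) by (intro witness_mono[OF g[of n]]) auto
    from witness_unique[OF g this assms(2) that(1) le(2)] show ?thesis by (simp add: h_def)
  qed
  have "witness \<sigma> e t q h" for t
  proof -
    obtain n :: nat where n: "t \<le> n" using real_arch_simple by blast
    have "continuous_on {0..real n} h"
      using g[of n] eq[of _ n] by (subst continuous_on_cong[of _ _ _ "g n"]) (auto simp: witness_def)
    then have "witness \<sigma> e n q h"
      using g[of n] eq[of _ n] by (auto simp: witness_def)
    then show ?thesis using n by (auto intro: witness_mono)
  qed
  then show ?thesis by (rule that)
qed

text \<open>Forward and backward witnesses glue to a reparametrization for all times. Expansivity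
  then puts \<open>x\<close> and \<open>y\<close> on one orbit with a time shift below
  \<open>\<eta>\<close>; as both lie in the section of \<open>x\<close>, uniqueness of section times
  makes the shift 0.\<close>

lemma escape_zero_imp_eq:
  assumes \<delta>: "\<And>h x y. continuous_on UNIV h \<Longrightarrow> h 0 = 0 \<Longrightarrow> (\<And>t. dist (\<phi> (h t) x) (\<phi> t y) < \<delta>) \<Longrightarrow>
      \<exists>s. \<bar>s\<bar> < \<eta> \<and> y = \<phi> s x"
    and \<epsilon>: "0 < \<epsilon>" "2 * \<epsilon> \<le> \<rho>" "2 * \<epsilon> < \<delta>"
    and q: "(x, y) \<in> Nsec \<phi> \<tau> \<epsilon>"
    and zero: "escape \<epsilon> 1 (x, y) = 0" "escape \<epsilon> (-1) (x, y) = 0"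
  shows "x = y"
proof -
  obtain f where f: "\<And>t. witness 1 (2 * \<epsilon>) t (x, y) f"
    using survives_forever_witness[OF escape_zero_imp_survives[OF zero(1) \<epsilon>(1)]] \<epsilon>(2) by blast
  obtain b where b: "\<And>t. witness (-1) (2 * \<epsilon>) t (x, y) b"
    using survives_forever_witness[OF escape_zero_imp_survives[OF zero(2) \<epsilon>(1)]] \<epsilon>(2) by blast
  define h where "h t = (if t \<le> 0 then b (- t) else f t)" for t
  have cont_ray: "continuous_on {0..} g" if "\<And>t. witness \<sigma> (2 * \<epsilon>) t (x, y) g" for \<sigma> g
    unfolding continuous_on_eq_continuous_within
  proof
    fix s :: real assume "s \<in> {0..}"
    \<comment> \<open>Ending the interval at \<open>s + 1\<close> makes it a neighbourhood of
      \<open>s\<close> in the ray.\<close>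
    have "continuous_on {0..s+1} g" using that by (auto simp: witness_def)
    then have "continuous (at s within {0..s+1}) g"
      using \<open>s \<in> {0..}\<close> by (simp add: continuous_on_eq_continuous_within)
    moreover have "at s within {0..s+1} = at s within {0..}"
      by (rule at_within_nhd[of _ "{..<s+1}"]) auto
    ultimately show "continuous (at s within {0..}) g" by simp
  qed
  have "continuous_on ({..0} \<union> {0..}) h"
    unfolding h_def
  proof (rule continuous_on_cases)
    show "continuous_on {..0} (\<lambda>t. b (- t))"
      by (rule continuous_on_compose2[OF cont_ray[OF b]]) (auto intro!: continuous_intros)
    show "continuous_on {0..} f" by (rule cont_ray[OF f])
    show "\<forall>t. t \<in> {..0} \<and> \<not> t \<le> 0 \<or> t \<in> {0..} \<and> t \<le> 0 \<longrightarrow> b (- t) = f t"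
      using f[of 0] b[of 0] by (auto simp: witness_def)
  qed auto
  moreover have "{..0} \<union> {0..} = (UNIV :: real set)" by auto
  ultimately have "continuous_on UNIV h" by simp
  moreover have "h 0 = 0" using b[of 0] by (simp add: h_def witness_def)
  \<comment> \<open>The orbit of \<open>y\<close> is the reparametrized one, so expansivity is used
    with \<open>x\<close> and \<open>y\<close> exchanged.\<close>
  moreover have "dist (\<phi> (h t) y) (\<phi> t x) < \<delta>" for t
    using witnessD(1)[OF f[of t], of t] witnessD(1)[OF b[of "-t"], of "-t"] \<epsilon>(3)
    by (cases "t \<le> 0") (auto simp: h_def dist_commute)
  ultimately obtain s where s: "\<bar>s\<bar> < \<eta>" "x = \<phi> s y" using \<delta>[of h y x] by blast
  have "s = 0"
    by (rule section_time_unique[of x y])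
      (use q s \<epsilon> \<eta>_pos is_flow_zero[OF flow] in \<open>auto simp: Nsec_def Hsec_def\<close>)
  then show ?thesis using s is_flow_zero[OF flow] by simp
qed

text \<open>The pair \<open>(x, x)\<close> stays on the diagonal forever with
  \<open>h s = \<sigma> * s\<close>, so no positive weight contributes.\<close>

lemma escape_diagonal:
  assumes "0 \<le> \<epsilon>"
  shows "escape \<epsilon> \<sigma> (x, x) = 0"
proof (rule antisym)
  have "witness \<sigma> (\<epsilon> + c) t (x, x) (\<lambda>s. \<sigma> * s)" if "0 < c" for c t
    using that assms by (auto simp: witness_def Hsec_def intro!: continuous_intros)
  then have "survives \<sigma> (\<epsilon> + c) t (x, x)" if "0 < c" for c t
    using that by (auto simp: survives_def)
  then show "escape \<epsilon> \<sigma> (x, x) \<le> 0" using assms by (intro escape_least) auto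
qed (rule escape_nonneg[OF assms])

section \<open>Transfer to the partial flow \<open>psi\<close>\<close>

lemma psi_witness_imp_witness:
  assumes "psi_witness \<phi> \<tau> \<epsilon> t q h"
  shows "witness (if 0 \<le> t then 1 else -1) \<epsilon> \<bar>t\<bar> q (\<lambda>s. h (if 0 \<le> t then s else - s))"
proof (cases "0 \<le> t")
  case True
  then show ?thesis using assms by (auto simp: psi_witness_def witness_def between0_def)
next
  case False
  have "continuous_on {0..\<bar>t\<bar>} (\<lambda>s. h (- s))"
    by (rule continuous_on_compose2[of "between0 t" h])
      (use assms False in \<open>auto simp: psi_witness_def between0_def intro!: continuous_intros\<close>)
  then show ?thesis using assms False by (auto simp: psi_witness_def witness_def between0_def)
qed

text \<open>For \<open>t < 0\<close> the orbit is followed with \<open>\<sigma> = -1\<close>, and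
  the two rules trade places: \<open>escape \<epsilon> (-1)\<close> grows by the factor
  \<open>exp \<bar>t\<bar> = exp (- t)\<close>, while \<open>escape \<epsilon> 1\<close> shrinks by
  \<open>exp (- \<bar>t\<bar>) = exp t\<close>.\<close>

lemma escape_psi:
  assumes t: "t \<in> psi_dom \<phi> \<tau> \<epsilon> q" and \<epsilon>: "0 \<le> \<epsilon>" "2 * \<epsilon> \<le> \<rho>"
  shows "escape \<epsilon> 1 (psi \<phi> \<tau> \<epsilon> t q) = exp t * escape \<epsilon> 1 q"
    and "escape \<epsilon> (-1) (psi \<phi> \<tau> \<epsilon> t q) = exp (- t) * escape \<epsilon> (-1) q"
proof -
  define h where "h = (SOME h. psi_witness \<phi> \<tau> \<epsilon> t q h)"
  have "\<exists>h. psi_witness \<phi> \<tau> \<epsilon> t q h" using t by (simp add: psi_dom_def psi_defined_def)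
  then have "psi_witness \<phi> \<tau> \<epsilon> t q h" unfolding h_def by (rule someI_ex)
  note w = psi_witness_imp_witness[OF this]
  have psi: "psi \<phi> \<tau> \<epsilon> t q
      = endpoint (if 0 \<le> t then 1 else -1) \<bar>t\<bar> q (\<lambda>s. h (if 0 \<le> t then s else - s))"
    by (auto simp: psi_def endpoint_def h_def)
  show "escape \<epsilon> 1 (psi \<phi> \<tau> \<epsilon> t q) = exp t * escape \<epsilon> 1 q"
    "escape \<epsilon> (-1) (psi \<phi> \<tau> \<epsilon> t q) = exp (- t) * escape \<epsilon> (-1) q"
    unfolding psi using escape_endpoint[OF w _ \<epsilon>] escape_endpoint_reverse[OF w _ \<epsilon>]
    by (cases "0 \<le> t"; simp)+
qed

end

section \<open>Sum and difference of the two exit values\<close>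

theorem mainTheorem13:
  fixes \<phi> :: "real \<Rightarrow> 'a::metric_space \<Rightarrow> 'a" and \<tau> :: real
  assumes "compact (UNIV :: 'a set)"
    and "is_flow \<phi>"
    and "expansive_flow \<phi>"
    and "\<forall>x. \<not> singular_point \<phi> x"
    and "cross_section_time \<phi> \<tau>"
  shows "\<exists>\<epsilon>0>0. \<forall>\<epsilon>. 0 < \<epsilon> \<and> \<epsilon> < \<epsilon>0 \<longrightarrow>
     (\<exists>L Ld :: 'a \<times> 'a \<Rightarrow> real.
        continuous_on (Nsec \<phi> \<tau> \<epsilon>) L \<and>
        (\<forall>x y. (x, y) \<in> Nsec \<phi> \<tau> \<epsilon> \<longrightarrow> L (x, y) \<ge> 0 \<and> (L (x, y) = 0 \<longleftrightarrow> x = y)) \<and>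
        (\<forall>q\<in>Nsec \<phi> \<tau> \<epsilon>.
           ((\<lambda>t. L (psi \<phi> \<tau> \<epsilon> t q)) has_real_derivative Ld q) (at 0 within psi_dom \<phi> \<tau> \<epsilon> q) \<and>
           ((\<lambda>t. Ld (psi \<phi> \<tau> \<epsilon> t q)) has_real_derivative L q) (at 0 within psi_dom \<phi> \<tau> \<epsilon> q)))"
proof -
  obtain a \<eta> \<rho> where "local_sections \<phi> \<tau> a \<eta> \<rho>"
    using local_sections_exist[OF assms(1,2,5)] by blast
  then interpret local_sections \<phi> \<tau> a \<eta> \<rho> .
  \<comment> \<open>Expansivity is invoked at precision \<open>\<eta>\<close>, the range in which
    section times are unique.\<close>
  obtain \<delta> where \<delta>: "\<delta> > 0"
    "\<And>h x y. continuous_on UNIV h \<Longrightarrow> h 0 = 0 \<Longrightarrow> (\<And>t. dist (\<phi> (h t) x) (\<phi> t y) < \<delta>) \<Longrightarrow>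
      \<exists>s. \<bar>s\<bar> < \<eta> \<and> y = \<phi> s x"
    using assms(3) \<eta>_pos unfolding expansive_flow_def by meson
  show ?thesis
  \<comment> \<open>\<open>\<rho>/4\<close> serves the continuity of the exit values;
    \<open>\<delta>/2\<close> makes orbits that stay within \<open>2 * \<epsilon>\<close> close
    enough for expansivity.\<close>
  proof (intro exI[of _ "min (\<rho>/4) (\<delta>/2)"] conjI allI impI)
    show "0 < min (\<rho>/4) (\<delta>/2)" using \<rho>_pos \<delta>(1) by simp
  next
    fix \<epsilon> assume "0 < \<epsilon> \<and> \<epsilon> < min (\<rho>/4) (\<delta>/2)"
    then have \<epsilon>: "0 < \<epsilon>" "0 \<le> \<epsilon>" "4 * \<epsilon> \<le> \<rho>" "2 * \<epsilon> \<le> \<rho>" "2 * \<epsilon> < \<delta>" by auto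
    let ?U = "escape \<epsilon> 1" and ?S = "escape \<epsilon> (-1)"
    have nn: "0 \<le> ?U q" "0 \<le> ?S q" for q
      using escape_nonneg[OF \<epsilon>(2)] by auto
    \<comment> \<open>This covers both derivatives at once: \<open>k = 1\<close> turns the sum into
      the difference, \<open>k = -1\<close> turns it back. On
      \<open>psi_dom \<phi> \<tau> \<epsilon> q\<close> the function \<open>F\<close> along the
      orbit is an explicit combination of \<open>exp t\<close> and \<open>exp (- t)\<close>.\<close>
    have deriv: "((\<lambda>t. F (psi \<phi> \<tau> \<epsilon> t q)) has_real_derivative ?U q - k * ?S q)
        (at 0 within psi_dom \<phi> \<tau> \<epsilon> q)"
      if q: "q \<in> Nsec \<phi> \<tau> \<epsilon>" and F: "\<And>p. F p = ?U p + k * ?S p" for q F k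
    proof (rule has_field_derivative_transform_within[of _ _ _ _ 1])
      show "((\<lambda>t. exp t * ?U q + k * (exp (- t) * ?S q)) has_real_derivative ?U q - k * ?S q)
          (at 0 within psi_dom \<phi> \<tau> \<epsilon> q)"
        by (auto intro!: derivative_eq_intros)
      have "psi_witness \<phi> \<tau> \<epsilon> 0 q (\<lambda>s. s)"
        using q by (auto simp: psi_witness_def between0_def Nsec_def is_flow_zero[OF flow])
      then show "0 \<in> psi_dom \<phi> \<tau> \<epsilon> q" by (auto simp: psi_dom_def psi_defined_def)
      show "exp t * ?U q + k * (exp (- t) * ?S q) = F (psi \<phi> \<tau> \<epsilon> t q)"
        if "t \<in> psi_dom \<phi> \<tau> \<epsilon> q" for t
        using escape_psi[OF that \<epsilon>(2,4)] F by simp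
    qed simp
    show "\<exists>L Ld :: 'a \<times> 'a \<Rightarrow> real.
        continuous_on (Nsec \<phi> \<tau> \<epsilon>) L \<and>
        (\<forall>x y. (x, y) \<in> Nsec \<phi> \<tau> \<epsilon> \<longrightarrow> L (x, y) \<ge> 0 \<and> (L (x, y) = 0 \<longleftrightarrow> x = y)) \<and>
        (\<forall>q\<in>Nsec \<phi> \<tau> \<epsilon>.
           ((\<lambda>t. L (psi \<phi> \<tau> \<epsilon> t q)) has_real_derivative Ld q) (at 0 within psi_dom \<phi> \<tau> \<epsilon> q) \<and>
           ((\<lambda>t. Ld (psi \<phi> \<tau> \<epsilon> t q)) has_real_derivative L q) (at 0 within psi_dom \<phi> \<tau> \<epsilon> q))"
    proof (rule exI[of _ "\<lambda>q. ?U q + ?S q"], rule exI[of _ "\<lambda>q. ?U q - ?S q"],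
        intro conjI allI impI ballI)
      show "continuous_on (Nsec \<phi> \<tau> \<epsilon>) (\<lambda>q. ?U q + ?S q)"
        using \<epsilon> by (intro continuous_on_add escape_continuous_on) auto
      fix x y assume xy: "(x, y) \<in> Nsec \<phi> \<tau> \<epsilon>"
      show "?U (x, y) + ?S (x, y) \<ge> 0" using nn by simp
      show "?U (x, y) + ?S (x, y) = 0 \<longleftrightarrow> x = y"
        using escape_zero_imp_eq[OF \<delta>(2) \<epsilon>(1,4,5) xy] escape_diagonal[OF \<epsilon>(2)]
          nn by (auto simp: add_nonneg_eq_0_iff)
    next
      fix q assume q: "q \<in> Nsec \<phi> \<tau> \<epsilon>"
      show "((\<lambda>t. ?U (psi \<phi> \<tau> \<epsilon> t q) + ?S (psi \<phi> \<tau> \<epsilon> t q)) has_real_derivative ?U q - ?S q)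
          (at 0 within psi_dom \<phi> \<tau> \<epsilon> q)"
        using deriv[OF q, of "\<lambda>q. ?U q + ?S q" 1] by simp
      show "((\<lambda>t. ?U (psi \<phi> \<tau> \<epsilon> t q) - ?S (psi \<phi> \<tau> \<epsilon> t q)) has_real_derivative ?U q + ?S q)
          (at 0 within psi_dom \<phi> \<tau> \<epsilon> q)"
        using deriv[OF q, of "\<lambda>q. ?U q - ?S q" "-1"] by simp
    qed
  qed
qed

end
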